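(* Let $d\in D_n$. Then $d$ is the diagonal of an idempotent in $M_n$ (i.e. there is $q\in M_n$ with $q^2=q$ and $E(q)=d$) if and only if one of the following holds: (i) $d=0$; (ii) $d=\mathrm{id}$; (iii) $\mathrm{Tr}\, d\in\{1,\ldots,n-1\}$.
   Context: $M_n$ denotes the $n\times n$ matrices over a fixed field which is either $\mathbb{R}$ or $\mathbb{C}$ (the result holds for both), $D_n\subset M_n$ is the subalgebra of diagonal matrices, and $E\colon M_n\to D_n$ is the linear map that keeps the diagonal entries and replaces all off-diagonal entries by $0$. Idempotents need not be self-adjoint. *)

theory Defs
  imports Complex_Main "Jordan_Normal_Form.Matrix"
begin

definition diag_algebra :: "nat \<Rightarrow> 'a::zero mat set" where
  "diag_algebra n = {A \<in> carrier_mat n n. diagonal_mat A}"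

definition diag_expectation :: "nat \<Rightarrow> 'a::zero mat \<Rightarrow> 'a mat" where
  "diag_expectation n A = mat_diag n (\<lambda>i. A $$ (i, i))"

text \<open>The trace in HOL-Analysis is only defined for the type-indexed matrices of that library.\<close>

definition mat_trace :: "'a::comm_monoid_add mat \<Rightarrow> 'a" where
  "mat_trace A = (\<Sum>i<dim_row A. A $$ (i, i))"

end

theory Submission
  imports Defs "Jordan_Normal_Form.Schur_Decomposition"
begin

text \<open>
  By the Schur decomposition an idempotent is similar to an upper triangular idempotent. The diagonal
  of the latter consists of zeros and ones, so its trace counts the ones; a strictly upper triangular
  idempotent is zero, which settles the extreme traces. Real matrices are regarded as complex ones.

  Conversely, let \<open>p\<close> be an idempotent of trace \<open>k\<close> whose last row has no zero entry, and conjugate it by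
  the shear \<open>I + x e\<^sup>T\<close>, where \<open>e\<close> is the last unit vector and \<open>x\<close> has last entry zero. For every row \<open>i\<close>
  but the last, this adds \<open>x\<^sub>i p\<^sub>n\<^sub>i\<close> to the \<open>i\<close>-th diagonal entry, so these entries can be prescribed
  independently. The last one is then forced by the trace.
\<close>

section \<open>Trace and similarity\<close>

lemma mat_trace_mult_comm:
  fixes A B :: "'a::comm_semiring_0 mat"
  assumes "A \<in> carrier_mat n m" "B \<in> carrier_mat m n"
  shows "mat_trace (A * B) = mat_trace (B * A)"
proof -
  have "mat_trace (A * B) = (\<Sum>i<n. \<Sum>k<m. A $$ (i, k) * B $$ (k, i))"
    using assms by (simp add: mat_trace_def scalar_prod_def atLeast0LessThan)
  also have "\<dots> = (\<Sum>k<m. \<Sum>i<n. B $$ (k, i) * A $$ (i, k))"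
    by (subst sum.swap) (simp add: mult.commute)
  also have "\<dots> = mat_trace (B * A)"
    using assms by (simp add: mat_trace_def scalar_prod_def atLeast0LessThan)
  finally show ?thesis .
qed

lemma mat_trace_similar:
  fixes A B :: "'a::comm_ring_1 mat"
  assumes "similar_mat_wit A B P Q"
  shows "mat_trace A = mat_trace B"
proof -
  define n where "n = dim_row A"
  note w = similar_mat_witD[OF n_def assms]
  have "mat_trace A = mat_trace (P * (B * Q))"
    using w by (simp add: assoc_mult_mat[of P n n B n Q n])
  also have "\<dots> = mat_trace (B * Q * P)"
    using w by (intro mat_trace_mult_comm[of _ n n]) auto
  also have "B * Q * P = B"
    using w by (simp add: assoc_mult_mat[of B n n Q n P n])
  finally show ?thesis .
qed

text \<open>In the square of \<open>P * B * Q\<close> the inner \<open>Q * P\<close> cancels. This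
  is used twice: to pass from an idempotent to its Schur form, and from the seed to its
  conjugate.\<close>

lemma idempotent_similar:
  fixes A B :: "'a::comm_ring_1 mat"
  assumes "similar_mat_wit A B P Q" and "B * B = B"
  shows "A * A = A"
proof -
  define n where "n = dim_row A"
  note w = similar_mat_witD[OF n_def assms(1)]
  have PB: "P * B \<in> carrier_mat n n" and BQ: "B * Q \<in> carrier_mat n n"
    using w by auto
  have "A * A = P * B * (Q * (P * B * Q))"
    unfolding w(3) using w by (intro assoc_mult_mat[of _ n n _ n _ n]) auto
  also have "Q * (P * B * Q) = Q * P * (B * Q)"
    unfolding assoc_mult_mat[OF w(6,5,7)] assoc_mult_mat[OF w(7,6) BQ] ..
  also have "\<dots> = B * Q"
    unfolding w(2) by (rule left_mult_one_mat[OF BQ])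
  also have "P * B * (B * Q) = P * (B * B) * Q"
    unfolding assoc_mult_mat[OF PB w(5,7), symmetric] assoc_mult_mat[OF w(6,5,5)] ..
  finally show ?thesis
    using w(3) assms(2) by simp
qed

lemma mat_trace_diag_expectation:
  assumes "q \<in> carrier_mat n n"
  shows "mat_trace (diag_expectation n q) = mat_trace q"
  using assms by (simp add: mat_trace_def diag_expectation_def mat_diag_def)

section \<open>The trace of an idempotent\<close>

text \<open>In the square, only products with i < k < j can contribute to the entry (i, j), and
  their first factor lies nearer to the diagonal. Induction on the distance from the diagonal
  therefore kills every entry.\<close>

lemma strictly_upper_triangular_idempotent_eq_0:
  fixes A :: "'a::semiring_1 mat"
  assumes A: "A \<in> carrier_mat n n" and ut: "upper_triangular A"
    and diag: "\<And>i. i < n \<Longrightarrow> A $$ (i, i) = 0" and idem: "A * A = A"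
  shows "A = 0\<^sub>m n n"
proof -
  have low: "A $$ (i, j) = 0" if "i < n" "j \<le> i" for i j
    using that diag ut A unfolding upper_triangular_def by (cases "i = j") auto
  have "A $$ (i, j) = 0" if "i < n" "j < n" for i j
    using that
  proof (induction "j - i" arbitrary: i j rule: less_induct)
    case less
    have "A $$ (i, j) = (\<Sum>k<n. A $$ (i, k) * A $$ (k, j))"
      using arg_cong[OF idem, of "\<lambda>M. M $$ (i, j)"] A less.prems
      by (simp add: scalar_prod_def atLeast0LessThan)
    also have "\<dots> = 0"
    proof (rule sum.neutral, rule ballI)
      fix k assume "k \<in> {..<n}"
      then have k: "k < n" by simp
      \<comment> \<open>For \<open>j \<le> i\<close>, where the truncated \<open>j - i\<close> is 0,
        the first two cases already exhaust all \<open>k\<close>.\<close>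
      consider "k \<le> i" | "j \<le> k" | "i < k" "k < j" by linarith
      then show "A $$ (i, k) * A $$ (k, j) = 0"
      proof cases
        case 3
        then have "A $$ (i, k) = 0" using less.hyps[of k i] less.prems k by simp
        then show ?thesis by simp
      qed (use low k less.prems in simp_all)
    qed
    finally show ?case .
  qed
  then show ?thesis using A by (intro eq_matI) auto
qed

text \<open>Off \<open>k = i\<close> one of the two factors lies below the diagonal. Hence the
  diagonal entries of a triangular idempotent are idempotent scalars.\<close>

lemma upper_triangular_diag_mult:
  fixes A :: "'a::semiring_1 mat"
  assumes A: "A \<in> carrier_mat n n" and ut: "upper_triangular A" and i: "i < n"
  shows "(A * A) $$ (i, i) = A $$ (i, i) * A $$ (i, i)"
proof -
  have "(A * A) $$ (i, i) = (\<Sum>k<n. A $$ (i, k) * A $$ (k, i))"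
    using A i by (simp add: scalar_prod_def atLeast0LessThan)
  also have "\<dots> = (\<Sum>k\<in>{i}. A $$ (i, k) * A $$ (k, i))"
  proof (rule sum.mono_neutral_right)
    show "\<forall>k\<in>{..<n} - {i}. A $$ (i, k) * A $$ (k, i) = 0"
    proof
      fix k assume k: "k \<in> {..<n} - {i}"
      then consider "k < i" | "i < k" "k < n" by fastforce
      then show "A $$ (i, k) * A $$ (k, i) = 0"
        using ut A i unfolding upper_triangular_def by cases auto
    qed
  qed (use i in auto)
  finally show ?thesis by simp
qed

text \<open>Complementation turns an all-ones diagonal into a zero diagonal, so the strictly
  triangular case also covers trace \<open>n\<close>.\<close>

lemma one_minus_idempotent:
  fixes A :: "'a::ring_1 mat"
  assumes A: "A \<in> carrier_mat n n" and idem: "A * A = A"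
  shows "(1\<^sub>m n - A) * (1\<^sub>m n - A) = 1\<^sub>m n - A"
proof -
  have c: "1\<^sub>m n - A \<in> carrier_mat n n" by (rule minus_carrier_mat[OF A])
  have "(1\<^sub>m n - A) * (1\<^sub>m n - A) = 1\<^sub>m n * (1\<^sub>m n - A) - A * (1\<^sub>m n - A)"
    by (rule minus_mult_distrib_mat[OF one_carrier_mat A c])
  also have "A * (1\<^sub>m n - A) = A * 1\<^sub>m n - A * A"
    by (rule mult_minus_distrib_mat[OF A one_carrier_mat A])
  also have "\<dots> = 0\<^sub>m n n"
    using A idem by auto
  also have "1\<^sub>m n * (1\<^sub>m n - A) - 0\<^sub>m n n = 1\<^sub>m n - A"
    unfolding left_mult_one_mat[OF c] using A by (intro eq_matI) auto
  finally show ?thesis .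
qed

lemma upper_triangular_idempotent_trace:
  fixes T :: "'a::{idom, ring_char_0} mat"
  assumes T: "T \<in> carrier_mat n n" and ut: "upper_triangular T" and idem: "T * T = T"
  shows "T = 0\<^sub>m n n \<or> T = 1\<^sub>m n \<or> mat_trace T \<in> of_nat ` {1..n - 1}"
proof -
  have diag01: "T $$ (i, i) = 0 \<or> T $$ (i, i) = 1" if "i < n" for i
    using upper_triangular_diag_mult[OF T ut that] idem by auto
  define S where "S = {i. i < n \<and> T $$ (i, i) = 1}"
  have S: "S \<subseteq> {..<n}" by (auto simp: S_def)
  have tr: "mat_trace T = of_nat (card S)"
  proof -
    have "mat_trace T = (\<Sum>i<n. if i \<in> S then 1 else 0)"
      unfolding mat_trace_def using T diag01 by (intro sum.cong) (auto simp: S_def)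
    also have "\<dots> = of_nat (card S)"
      using S by (simp add: sum.If_cases Int_absorb1)
    finally show ?thesis .
  qed
  have fin: "finite S" using S finite_subset by blast
  consider "S = {}" | "S = {..<n}" | "S \<noteq> {}" "S \<subset> {..<n}" using S by blast
  then show ?thesis
  proof cases
    case 1
    then have "T $$ (i, i) = 0" if "i < n" for i
      using diag01[OF that] that by (auto simp: S_def)
    then show ?thesis
      using strictly_upper_triangular_idempotent_eq_0[OF T ut _ idem] by blast
  next
    case 2
    have "1\<^sub>m n - T = 0\<^sub>m n n"
    proof (rule strictly_upper_triangular_idempotent_eq_0)
      show "upper_triangular (1\<^sub>m n - T)"
        using T ut unfolding upper_triangular_def by auto
      show "(1\<^sub>m n - T) $$ (i, i) = 0" if "i < n" for i
        using 2 T that by (auto simp: S_def)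
    qed (use T one_minus_idempotent[OF T idem] in auto)
    have "T $$ (i, j) = 1\<^sub>m n $$ (i, j)" if "i < n" "j < n" for i j
      using arg_cong[OF \<open>1\<^sub>m n - T = 0\<^sub>m n n\<close>, of "\<lambda>M. M $$ (i, j)"] T that by simp
    then have "T = 1\<^sub>m n" using T by (intro eq_matI) auto
    then show ?thesis by simp
  next
    case 3
    have "card S < n" using psubset_card_mono[OF _ 3(2)] by simp
    moreover have "card S \<noteq> 0" using 3 fin by simp
    ultimately have "card S \<in> {1..n - 1}" by auto
    then show ?thesis using tr by blast
  qed
qed

section \<open>From triangular to arbitrary complex and real idempotents\<close>

lemma complex_idempotent_trace:
  fixes q :: "complex mat"
  assumes q: "q \<in> carrier_mat n n" and idem: "q * q = q"
  shows "q = 0\<^sub>m n n \<or> q = 1\<^sub>m n \<or> mat_trace q \<in> of_nat ` {1..n - 1}"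
proof -
  \<comment> \<open>Over the complex numbers the characteristic polynomial splits, as the Schur
    decomposition requires.\<close>
  obtain es where "char_poly q = (\<Prod>a\<leftarrow>es. [:- a, 1:])"
    using char_poly_factorized[OF q] by blast
  from schur_decomposition_exists[OF q this] obtain T P Q
    where T: "T \<in> carrier_mat n n" "upper_triangular T" and sim: "similar_mat_wit q T P Q"
    unfolding similar_mat_def by blast
  note w = similar_mat_witD2[OF q sim]
  have "T * T = T"
    using idempotent_similar[OF similar_mat_wit_sym[OF sim] idem] .
  from upper_triangular_idempotent_trace[OF T this] show ?thesis
    using mat_trace_similar[OF sim] w by auto
qed

text \<open>A real characteristic polynomial need not split. The entrywise embedding into complex
  matrices is an injective ring homomorphism that commutes with the trace, so each alternative
  descends.\<close>

lemma real_idempotent_trace: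
  fixes q :: "real mat"
  assumes q: "q \<in> carrier_mat n n" and idem: "q * q = q"
  shows "q = 0\<^sub>m n n \<or> q = 1\<^sub>m n \<or> mat_trace q \<in> of_nat ` {1..n - 1}"
proof -
  define c where "c = map_mat complex_of_real q"
  have c: "c \<in> carrier_mat n n" using q by (simp add: c_def)
  have "c * c = c"
    using of_real_hom.mat_hom_mult[OF q q] idem unfolding c_def by metis
  from complex_idempotent_trace[OF c this]
  consider "c = 0\<^sub>m n n" | "c = 1\<^sub>m n" | k where "k \<in> {1..n - 1}" "mat_trace c = of_nat k" by blast
  then show ?thesis
  proof cases
    case 1
    then have "c = map_mat complex_of_real (0\<^sub>m n n)" by auto
    then show ?thesis unfolding c_def using of_real_hom.mat_hom_inj by blast
  next
    case 2
    then have "c = map_mat complex_of_real (1\<^sub>m n)" by (simp add: of_real_hom.mat_hom_one)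
    then show ?thesis unfolding c_def using of_real_hom.mat_hom_inj by blast
  next
    case 3
    have "mat_trace c = complex_of_real (mat_trace q)"
      using q by (simp add: mat_trace_def c_def)
    then have "complex_of_real (mat_trace q) = complex_of_real (of_nat k)" using 3(2) by simp
    then have "mat_trace q = of_nat k" unfolding of_real_eq_iff .
    then show ?thesis using 3(1) by blast
  qed
qed

section \<open>Prescribing the diagonal\<close>

text \<open>The first \<open>k\<close> rows are those of \<open>diag (1,\<dots>,1,0,\<dots>,0) + (1,\<dots>,1)\<close>, the last row makes every
  column sum zero; the only point of this choice is that the last row has no zero entry.\<close>

definition seed_idempotent :: "nat \<Rightarrow> nat \<Rightarrow> 'a::field_char_0 mat" where
  "seed_idempotent n k = Matrix.mat n n (\<lambda>(i, j).
     if i < k then of_bool (i = j) + 1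
     else if i = n - 1 then - (of_bool (j < k) + of_nat k) else 0)"

lemma seed_idempotent_carrier: "seed_idempotent n k \<in> carrier_mat n n"
  by (simp add: seed_idempotent_def)

text \<open>Rows \<open>k\<close> to \<open>n - 2\<close> of the seed vanish, so sums over its rows
  take this shape.\<close>

lemma sum_eq_initial_and_last:
  fixes f :: "nat \<Rightarrow> 'a::comm_monoid_add"
  assumes "k < n" and "\<And>l. k \<le> l \<Longrightarrow> l < n - 1 \<Longrightarrow> f l = 0"
  shows "(\<Sum>l<n. f l) = (\<Sum>l<k. f l) + f (n - 1)"
proof -
  have "(\<Sum>l<n. f l) = (\<Sum>l\<in>insert (n - 1) {..<k}. f l)"
  proof (rule sum.mono_neutral_right)
    show "\<forall>l\<in>{..<n} - insert (n - 1) {..<k}. f l = 0"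
    proof
      fix l assume "l \<in> {..<n} - insert (n - 1) {..<k}"
      then have "k \<le> l" "l < n - 1" by auto
      then show "f l = 0" by (rule assms(2))
    qed
  qed (use assms(1) in auto)
  then show ?thesis using assms(1) by (simp add: add.commute)
qed

lemma seed_idempotent_trace:
  assumes "k < n"
  shows "mat_trace (seed_idempotent n k :: 'a::field_char_0 mat) = of_nat k"
proof -
  let ?q = "seed_idempotent n k :: 'a mat"
  have "mat_trace ?q = (\<Sum>i<k. ?q $$ (i, i)) + ?q $$ (n - 1, n - 1)"
    unfolding mat_trace_def using assms
    by (subst sum_eq_initial_and_last[of k]) (auto simp: seed_idempotent_def)
  also have "\<dots> = of_nat k"
    using assms by (simp add: seed_idempotent_def)
  finally show ?thesis .
qed

text \<open>The seed factors as \<open>U V\<close>, where for \<open>l < k\<close> the columns of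
  \<open>U\<close> are \<open>e_l - e_(n-1)\<close> and the rows of \<open>V\<close> are
  \<open>e_l + (1,...,1)\<close>. As \<open>V U\<close> is the identity of size \<open>k\<close>,
  the product \<open>U V\<close> is idempotent; the proof verifies this entry by entry.\<close>

lemma seed_idempotent_idempotent:
  assumes "k < n"
  shows "seed_idempotent n k * seed_idempotent n k = (seed_idempotent n k :: 'a::field_char_0 mat)"
proof (rule eq_matI)
  let ?q = "seed_idempotent n k :: 'a mat"
  fix i j
  assume "i < dim_row ?q" "j < dim_col ?q"
  then have ij: "i < n" "j < n" by (simp_all add: seed_idempotent_def)
  \<comment> \<open>\<open>colsum\<close> and \<open>last\<close> are opposite because the columns
    of the seed sum to zero; this cancels the constant part of the first \<open>k\<close>
    rows.\<close>
  have colsum: "(\<Sum>l<k. ?q $$ (l, j)) = of_bool (j < k) + of_nat k"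
    using ij assms by (simp add: seed_idempotent_def sum.distrib of_bool_def)
  have last: "?q $$ (n - 1, j) = - (of_bool (j < k) + of_nat k)"
    using ij assms by (simp add: seed_idempotent_def)
  have "(?q * ?q) $$ (i, j) = (\<Sum>l<n. ?q $$ (i, l) * ?q $$ (l, j))"
    using ij seed_idempotent_carrier[of n k, where 'a = 'a] by (simp add: scalar_prod_def atLeast0LessThan)
  also have "\<dots> = (\<Sum>l<k. ?q $$ (i, l) * ?q $$ (l, j)) + ?q $$ (i, n - 1) * ?q $$ (n - 1, j)"
    using assms ij by (intro sum_eq_initial_and_last) (auto simp: seed_idempotent_def)
  also have "\<dots> = ?q $$ (i, j)"
  proof -
    consider "i < k" | "k \<le> i" "i = n - 1" | "k \<le> i" "i \<noteq> n - 1" by linarith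
    then show ?thesis
    proof cases
      case 1
      have "(\<Sum>l<k. ?q $$ (i, l) * ?q $$ (l, j)) = (\<Sum>l<k. of_bool (i = l) * ?q $$ (l, j) + ?q $$ (l, j))"
        using 1 ij assms by (intro sum.cong) (auto simp: seed_idempotent_def)
      also have "\<dots> = ?q $$ (i, j) + (of_bool (j < k) + of_nat k)"
        unfolding sum.distrib colsum using 1 by (simp add: of_bool_def if_distrib if_distribR cong: if_cong)
      finally have *: "(\<Sum>l<k. ?q $$ (i, l) * ?q $$ (l, j)) = ?q $$ (i, j) + (of_bool (j < k) + of_nat k)" .
      have "?q $$ (i, n - 1) = 1" using 1 ij assms by (simp add: seed_idempotent_def)
      then show ?thesis unfolding * last by simp
    next
      case 2
      \<comment> \<open>The last row has entries -(1 + k) in the first \<open>k\<close> columns and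
        -k in the last one. With c the value of \<open>colsum\<close>, the total is -(1 + k) c + k c
        = -c.\<close>
      have "(\<Sum>l<k. ?q $$ (i, l) * ?q $$ (l, j)) = (\<Sum>l<k. - (1 + of_nat k) * ?q $$ (l, j))"
        using 2 ij assms by (intro sum.cong) (auto simp: seed_idempotent_def)
      also have "\<dots> = - (1 + of_nat k) * (of_bool (j < k) + of_nat k)"
        unfolding sum_distrib_left[symmetric] colsum ..
      finally have *: "(\<Sum>l<k. ?q $$ (i, l) * ?q $$ (l, j)) = - (1 + of_nat k) * (of_bool (j < k) + of_nat k)" .
      have "?q $$ (i, n - 1) = - of_nat k" using 2 ij assms by (simp add: seed_idempotent_def)
      then show ?thesis unfolding * last using 2 last by (simp add: algebra_simps)
    next
      case 3
      then show ?thesis using ij assms by (simp add: seed_idempotent_def)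
    qed
  qed
  finally show "(?q * ?q) $$ (i, j) = ?q $$ (i, j)" .
qed (simp_all add: seed_idempotent_def)

text \<open>These entries are the divisors in the choice of the shear. Each is -k or -(k + 1),
  nonzero in characteristic zero since \<open>1 \<le> k\<close>.\<close>

lemma seed_idempotent_last_row:
  assumes "1 \<le> k" "k < n" "j < n"
  shows "(seed_idempotent n k :: 'a::field_char_0 mat) $$ (n - 1, j) \<noteq> 0"
proof -
  have "of_bool (j < k) + of_nat k = (of_nat (of_bool (j < k) + k) :: 'a)" by simp
  also have "\<dots> \<noteq> 0" using assms(1) unfolding of_nat_eq_0_iff by simp
  finally have "- (of_bool (j < k) + of_nat k) \<noteq> (0 :: 'a)"
    unfolding neg_equal_0_iff_equal .
  moreover have "(seed_idempotent n k :: 'a mat) $$ (n - 1, j) = - (of_bool (j < k) + of_nat k)"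
    using assms by (simp add: seed_idempotent_def)
  ultimately show ?thesis by simp
qed

section \<open>Shears along the last column\<close>

definition last_column_shear :: "nat \<Rightarrow> (nat \<Rightarrow> 'a) \<Rightarrow> 'a::ring_1 mat" where
  "last_column_shear n x = Matrix.mat n n (\<lambda>(i, j).
     of_bool (i = j) + (if j = n - 1 \<and> i \<noteq> n - 1 then x i else 0))"

lemma last_column_shear_carrier: "last_column_shear n x \<in> carrier_mat n n"
  by (simp add: last_column_shear_def)

lemma last_column_shear_mult_index:
  fixes A :: "'a::ring_1 mat"
  assumes A: "A \<in> carrier_mat n n" and ij: "i < n" "j < n"
  shows "(last_column_shear n x * A) $$ (i, j)
    = A $$ (i, j) + (if i \<noteq> n - 1 then x i * A $$ (n - 1, j) else 0)"
proof -
  let ?f = "\<lambda>l. (if l = i then A $$ (i, j) else 0)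
    + (if l = n - 1 then if i \<noteq> n - 1 then x i * A $$ (n - 1, j) else 0 else 0)"
  have "(last_column_shear n x * A) $$ (i, j) = (\<Sum>l<n. last_column_shear n x $$ (i, l) * A $$ (l, j))"
    using A ij last_column_shear_carrier[of n x] by (simp add: scalar_prod_def atLeast0LessThan)
  also have "\<dots> = (\<Sum>l<n. ?f l)"
    using ij by (intro sum.cong) (auto simp: last_column_shear_def)
  finally show ?thesis using ij by (simp add: sum.distrib)
qed

text \<open>The guard \<open>i \<noteq> n - 1\<close> in the shear clears the last coordinate of
  \<open>x\<close>, so the part beyond the identity squares to zero and negating \<open>x\<close>
  inverts the shear.\<close>

lemma last_column_shear_inverse:
  fixes x :: "nat \<Rightarrow> 'a::ring_1"
  shows "last_column_shear n x * last_column_shear n (\<lambda>i. - x i) = 1\<^sub>m n"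
proof (rule eq_matI)
  fix i j assume "i < dim_row (1\<^sub>m n :: 'a mat)" "j < dim_col (1\<^sub>m n :: 'a mat)"
  then have ij: "i < n" "j < n" by simp_all
  then show "(last_column_shear n x * last_column_shear n (\<lambda>i. - x i)) $$ (i, j) = 1\<^sub>m n $$ (i, j)"
    by (simp add: last_column_shear_mult_index[OF last_column_shear_carrier])
       (auto simp: last_column_shear_def)
qed (simp_all add: last_column_shear_def)

text \<open>Right multiplication by a shear alters only the last column, so all diagonal entries of
  \<open>S * p * T\<close> but the last can be read off from \<open>S * p\<close>.\<close>

lemma mult_last_column_shear_index:
  fixes A :: "'a::ring_1 mat"
  assumes A: "A \<in> carrier_mat n n" and ij: "i < n" "j < n - 1"
  shows "(A * last_column_shear n x) $$ (i, j) = A $$ (i, j)"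
proof -
  have "(A * last_column_shear n x) $$ (i, j) = (\<Sum>l<n. if l = j then A $$ (i, j) else 0)"
    using assms
    by (auto simp: last_column_shear_def scalar_prod_def atLeast0LessThan intro!: sum.cong)
  moreover have "j < n" using ij by simp
  ultimately show ?thesis by simp
qed

section \<open>Realising a diagonal of given trace\<close>

lemma exists_idempotent_with_diagonal:
  fixes d :: "'a::field_char_0 mat"
  assumes d: "d \<in> diag_algebra n" and k: "k \<in> {1..n - 1}" and tr: "mat_trace d = of_nat k"
  shows "\<exists>q \<in> carrier_mat n n. q * q = q \<and> diag_expectation n q = d"
proof -
  have dc: "d \<in> carrier_mat n n" and dd: "diagonal_mat d" using d by (simp_all add: diag_algebra_def)
  have k': "1 \<le> k" "k < n" using k by auto
  define p where "p = (seed_idempotent n k :: 'a mat)"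
  \<comment> \<open>The solution of
    \<open>p $$ (i, i) + x i * p $$ (n - 1, i) = d $$ (i, i)\<close>; its value at
    \<open>n - 1\<close> is discarded by the shear.\<close>
  define x where "x i = (d $$ (i, i) - p $$ (i, i)) / p $$ (n - 1, i)" for i
  define S where "S = last_column_shear n x"
  define T where "T = last_column_shear n (\<lambda>i. - x i)"
  define q where "q = S * p * T"
  have carr: "p \<in> carrier_mat n n" "S \<in> carrier_mat n n" "T \<in> carrier_mat n n"
    by (simp_all add: p_def S_def T_def seed_idempotent_carrier last_column_shear_carrier)
  then have qc: "q \<in> carrier_mat n n" by (simp add: q_def)
  have ST: "S * T = 1\<^sub>m n" "T * S = 1\<^sub>m n"
    using last_column_shear_inverse[of n x] last_column_shear_inverse[of n "\<lambda>i. - x i"]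
    by (simp_all add: S_def T_def)
  have sim: "similar_mat_wit q p S T"
    using carr qc ST unfolding similar_mat_wit_def Let_def q_def by auto
  have idem: "q * q = q"
    using idempotent_similar[OF sim] seed_idempotent_idempotent[OF k'(2)] by (simp add: p_def)
  have trq: "mat_trace q = mat_trace d"
    using mat_trace_similar[OF sim] seed_idempotent_trace[OF k'(2)] tr by (simp add: p_def)
  have diag: "q $$ (i, i) = d $$ (i, i)" if i: "i < n - 1" for i
  proof -
    have "q $$ (i, i) = (S * p) $$ (i, i)"
      unfolding q_def T_def using carr i by (intro mult_last_column_shear_index) auto
    also have "\<dots> = p $$ (i, i) + x i * p $$ (n - 1, i)"
      unfolding S_def using carr(1) i by (subst last_column_shear_mult_index[of _ n]) auto
    also have "\<dots> = d $$ (i, i)"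
      using seed_idempotent_last_row[of k n i, where 'a = 'a] k' i by (simp add: x_def p_def)
    finally show ?thesis .
  qed
  \<comment> \<open>With \<open>n = Suc m\<close> the trace splits off its last term, so equal
    traces and equal earlier entries force equality at \<open>m\<close>.\<close>
  obtain m where m: "n = Suc m" using k' by (cases n) auto
  have "(\<Sum>i<m. q $$ (i, i)) = (\<Sum>i<m. d $$ (i, i))"
    using diag m by (intro sum.cong) auto
  then have "q $$ (m, m) = d $$ (m, m)"
    using trq qc dc by (simp add: mat_trace_def m)
  then have all: "q $$ (i, i) = d $$ (i, i)" if "i < n" for i
    using diag that m by (cases "i = m") auto
  have "diag_expectation n q = d"
    using all dc dd by (intro eq_matI) (auto simp: diag_expectation_def mat_diag_def diagonal_mat_def)
  then show ?thesis using qc idem by blast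
qed

text \<open>The choice of field enters only through \<open>forward\<close>, so the real and complex
  cases share this argument; the converse works over any field of characteristic zero.\<close>

lemma diagonals_of_idempotents:
  fixes d :: "'a::field_char_0 mat"
  assumes forward: "\<And>q :: 'a mat. q \<in> carrier_mat n n \<Longrightarrow> q * q = q \<Longrightarrow>
      q = 0\<^sub>m n n \<or> q = 1\<^sub>m n \<or> mat_trace q \<in> of_nat ` {1..n - 1}"
    and d: "d \<in> diag_algebra n"
  shows "(\<exists>q \<in> carrier_mat n n. q * q = q \<and> diag_expectation n q = d)
    \<longleftrightarrow> d = 0\<^sub>m n n \<or> d = 1\<^sub>m n \<or> mat_trace d \<in> of_nat ` {1..n - 1}"
    (is "?L \<longleftrightarrow> ?R")
proof -
  have zero: "diag_expectation n (0\<^sub>m n n) = (0\<^sub>m n n :: 'a mat)"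
    by (intro eq_matI) (auto simp: diag_expectation_def mat_diag_def)
  have one: "diag_expectation n (1\<^sub>m n) = (1\<^sub>m n :: 'a mat)"
    by (intro eq_matI) (auto simp: diag_expectation_def mat_diag_def)
  show ?thesis
  proof
    assume ?L
    then obtain q where q: "q \<in> carrier_mat n n" "q * q = q" and "diag_expectation n q = d" by blast
    \<comment> \<open>The alternatives for \<open>q\<close> pass to \<open>d\<close> because
      \<open>diag_expectation\<close> fixes zero and the identity and preserves the trace.\<close>
    then show ?R using forward[OF q] zero one mat_trace_diag_expectation[OF q(1)] by auto
  next
    assume ?R
    then consider "d = 0\<^sub>m n n" | "d = 1\<^sub>m n" | k where "k \<in> {1..n - 1}" "mat_trace d = of_nat k"
      by blast
    then show ?L
    proof cases
      case 1
      then show ?thesis using zero by (intro bexI[of _ "0\<^sub>m n n"]) auto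
    next
      case 2
      then show ?thesis using one by (intro bexI[of _ "1\<^sub>m n"]) auto
    next
      case 3
      then show ?thesis by (rule exists_idempotent_with_diagonal[OF d])
    qed
  qed
qed

theorem theorem5p1:
  fixes n :: nat
  shows
    "(\<forall>d :: real mat. d \<in> diag_algebra n \<longrightarrow>
        ((\<exists>q \<in> carrier_mat n n. q * q = q \<and> diag_expectation n q = d)
          \<longleftrightarrow> d = 0\<^sub>m n n \<or> d = 1\<^sub>m n \<or> mat_trace d \<in> of_nat ` {1..n - 1}))
   \<and> (\<forall>d :: complex mat. d \<in> diag_algebra n \<longrightarrow>
        ((\<exists>q \<in> carrier_mat n n. q * q = q \<and> diag_expectation n q = d)
          \<longleftrightarrow> d = 0\<^sub>m n n \<or> d = 1\<^sub>m n \<or> mat_trace d \<in> of_nat ` {1..n - 1}))"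
  using diagonals_of_idempotents[OF real_idempotent_trace]
    diagonals_of_idempotents[OF complex_idempotent_trace] by blast

end
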